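(* If a pointed coarse space $(X,\xi)$ is non-scattering at infinity, then $\iota(X,\xi)$ is an empty set or a singleton.
   Context: Work in a nonstandard universe, with extension map $A\mapsto{}^{\ast}A$, satisfying the transfer principle and the saturation principle (every family of internal sets that has the finite intersection property and is indexed by a standard set has nonempty intersection). A coarse structure on a set $X$ is a family $\mathcal{C}_X$ of binary relations on $X$ that contains the diagonal $\Delta_X$ and is closed under subsets, finite unions, compositions and inverses; a coarse space is a set with a coarse structure. A pointed coarse space $(X,\xi)$ is a coarse space $X$ with a base point $\xi\in X$. A set $B\subseteq X$ is bounded if $B\times B\in\mathcal{C}_X$; $\mathcal{B}_X(\xi)$ denotes the set of bounded subsets of $X$ containing $\xi$, ordered by inclusion. For $E\in\mathcal{C}_X$, a subset $A\subseteq X$ is $E$-connected if $A\times A=\bigcup_{n\in\mathbb{N}}(E\cap(A\times A))^n$, where the exponent denotes $n$-fold composition of relations on $A$ (with $0$-th power the diagonal of $A$); i.e. for any $x,y\in A$ there is a finite sequence $x=s_0,\dots,s_n=y$ in $A$ with $(s_i,s_{i+1})\in E$ for all $i<n$. The pointed coarse space $(X,\xi)$ is non-scattering at infinity if there exists $E\in\mathcal{C}_X$ such that $\{B\in\mathcal{B}_X(\xi) : X\setminus B\text{ is }E\text{-connected}\}$ is cofinal in $\mathcal{B}_X(\xi)$, i.e. for every $A\in\mathcal{B}_X(\xi)$ there is $B\in\mathcal{B}_X(\xi)$ with $B\supseteq A$ and $X\setminus B$ $E$-connected. For $x,y\in{}^{\ast}X$ write $x\sim_X y$ (finitely close) if $(x,y)\in{}^{\ast}E$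 for some $E\in\mathcal{C}_X$. Let $\mathrm{FIN}(X,\xi)=\{x\in{}^{\ast}X : x\sim_X\xi\}$ and $\mathrm{INF}(X,\xi)={}^{\ast}X\setminus\mathrm{FIN}(X,\xi)$. For $x,y\in\mathrm{INF}(X,\xi)$ write $x\equiv^{\iota}_{X,\xi}y$ if there are $n\in{}^{\ast}\mathbb{N}$ and an internal hyperfinite sequence $\{s_i\}_{i\le n}$ of points of $\mathrm{INF}(X,\xi)$ with $s_0=x$, $s_n=y$ and $s_i\sim_X s_{i+1}$ for all $i<n$. This is an equivalence relation, and $\iota(X,\xi)$ is the set of its equivalence classes. *)

theory Defs
  imports Main
begin

section \<open>Bounded formulas of the language of set theory\<close>

text \<open>
  Variables are named by natural numbers; \<open>BAll i j \<phi>\<close> stands for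
  \<open>\<forall>v\<^sub>i \<in> v\<^sub>j. \<phi>\<close>.
\<close>

datatype fm =
    Mem nat nat
  | Eq nat nat
  | Neg fm
  | Conj fm fm
  | BAll nat nat fm

primrec sat :: "('m \<Rightarrow> 'm \<Rightarrow> bool) \<Rightarrow> fm \<Rightarrow> (nat \<Rightarrow> 'm) \<Rightarrow> bool" where
  "sat R (Mem i j) e \<longleftrightarrow> R (e i) (e j)"
| "sat R (Eq i j) e \<longleftrightarrow> e i = e j"
| "sat R (Neg \<phi>) e \<longleftrightarrow> \<not> sat R \<phi> e"
| "sat R (Conj \<phi> \<psi>) e \<longleftrightarrow> sat R \<phi> e \<and> sat R \<psi> e"
| "sat R (BAll i j \<phi>) e \<longleftrightarrow> (\<forall>z. R z (e j) \<longrightarrow> sat R \<phi> (e(i := z)))"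


section \<open>Nonstandard universes\<close>

text \<open>
  The type \<open>'u\<close> is the standard universe, with membership \<open>smem\<close>; the objects that do
  not satisfy \<open>setp\<close> are urelements.  The type \<open>'v\<close> is the nonstandard universe, with
  membership \<open>imem\<close>, and \<open>star\<close> is the extension map.  The field \<open>num\<close> says which
  standard objects serve as the natural numbers, so that both von Neumann numerals and
  numerals that are urelements are covered.
\<close>

record ('u, 'v) universe =
  smem :: "'u \<Rightarrow> 'u \<Rightarrow> bool"
  setp :: "'u \<Rightarrow> bool"
  num  :: "nat \<Rightarrow> 'u"
  imem :: "'v \<Rightarrow> 'v \<Rightarrow> bool"
  star :: "'u \<Rightarrow> 'v"

definition elts :: "('u, 'v) universe \<Rightarrow> 'u \<Rightarrow> 'u set" where
  "elts U a = {x. smem U x a}"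

text \<open>A set of standard objects is small if it is (the extension of) a standard set.\<close>

definition small :: "('u, 'v) universe \<Rightarrow> 'u set \<Rightarrow> bool" where
  "small U A \<longleftrightarrow> (\<exists>a. setp U a \<and> elts U a = A)"

definition code :: "('u, 'v) universe \<Rightarrow> 'u set \<Rightarrow> 'u" where
  "code U A = (THE a. setp U a \<and> elts U a = A)"

definition internal :: "('u, 'v) universe \<Rightarrow> 'v \<Rightarrow> bool" where
  "internal U v \<longleftrightarrow> (\<exists>a. setp U a \<and> imem U v (star U a))"

text \<open>
  The axioms from \<open>wf_smem\<close> to \<open>small_Union\<close> say that the standard universe is, up to
  isomorphism, a transitive universe of sets over urelements that contains every subset of
  each of its sets and is closed under pairing, power set and union.  Examples are
  the superstructure over an infinite set of urelements and \<open>V\<^sub>\<lambda>\<close> for a limit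
  ordinal \<open>\<lambda> > \<omega>\<close>.  Transfer is only required for bounded formulas, and saturation only
  for internal sets in the sense of superstructures, that is, elements of some \<open>star U a\<close>;
  both hold a fortiori when \<open>star\<close> is a fully elementary saturated embedding.
\<close>

locale nonstandard_universe =
  fixes U :: "('u, 'v) universe"
  assumes wf_smem: "wfP (smem U)"
    and smem_setp: "smem U x a \<Longrightarrow> setp U a"
    and extensionality: "\<lbrakk>setp U a; setp U b; elts U a = elts U b\<rbrakk> \<Longrightarrow> a = b"
    and small_subset: "\<lbrakk>small U A; B \<subseteq> A\<rbrakk> \<Longrightarrow> small U B"
    and small_pair: "small U {x, y}"
    and small_Pow: "small U A \<Longrightarrow> small U {b. setp U b \<and> elts U b \<subseteq> A}"
    and small_Union: "small U A \<Longrightarrow> small U (\<Union>a\<in>A. elts U a)"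
    and inj_num: "inj (num U)"
    and small_num: "small U (range (num U))"
    and transfer_principle: "sat (smem U) \<phi> e \<longleftrightarrow> sat (imem U) \<phi> (star U \<circ> e)"
    and saturation_principle:
      "\<lbrakk>small U I;
        \<forall>i\<in>I. internal U (F i);
        \<forall>J. finite J \<and> J \<subseteq> I \<longrightarrow> (\<exists>z. \<forall>i\<in>J. imem U z (F i))\<rbrakk>
       \<Longrightarrow> \<exists>z. \<forall>i\<in>I. imem U z (F i)"

text \<open>
  \<open>is_pair R p x y\<close>: with respect to the membership relation \<open>R\<close>, the object \<open>p\<close> is the
  Kuratowski pair \<open>{{x}, {x, y}}\<close>.
\<close>

definition is_pair :: "('m \<Rightarrow> 'm \<Rightarrow> bool) \<Rightarrow> 'm \<Rightarrow> 'm \<Rightarrow> 'm \<Rightarrow> bool" where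
  "is_pair R p x y \<longleftrightarrow>
     (\<exists>a b. (\<forall>z. R z p \<longleftrightarrow> z = a \<or> z = b) \<and>
            (\<forall>z. R z a \<longleftrightarrow> z = x) \<and>
            (\<forall>z. R z b \<longleftrightarrow> z = x \<or> z = y))"

text \<open>The nonstandard extensions of a small set and of a relation between small sets.\<close>

definition star_set :: "('u, 'v) universe \<Rightarrow> 'u set \<Rightarrow> 'v set" where
  "star_set U A = {x. imem U x (star U (code U A))}"

definition star_rel :: "('u, 'v) universe \<Rightarrow> ('u \<times> 'u) set \<Rightarrow> ('v \<times> 'v) set" where
  "star_rel U E =
     {(x, y). \<exists>p \<in> star_set U {q. \<exists>(a, b)\<in>E. is_pair (smem U) q a b}. is_pair (imem U) p x y}"

definition hypernats :: "('u, 'v) universe \<Rightarrow> 'v set" where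
  "hypernats U = star_set U (range (num U))"

definition hyper_le :: "('u, 'v) universe \<Rightarrow> ('v \<times> 'v) set" where
  "hyper_le U = star_rel U {(num U m, num U k) | m k. m \<le> k}"

definition hyper_less :: "('u, 'v) universe \<Rightarrow> ('v \<times> 'v) set" where
  "hyper_less U = star_rel U {(num U m, num U k) | m k. m < k}"

definition hyper_suc :: "('u, 'v) universe \<Rightarrow> ('v \<times> 'v) set" where
  "hyper_suc U = star_rel U {(num U m, num U (Suc m)) | m. True}"

text \<open>
  The family \<open>{s i}\<^sub>i\<^sub>\<le>\<^sub>n\<close> is internal: its graph is the extension of an internal set.
  The values of \<open>s\<close> off \<open>{i. i \<le> n}\<close> are irrelevant.
\<close>

definition internal_sequence :: "('u, 'v) universe \<Rightarrow> 'v \<Rightarrow> ('v \<Rightarrow> 'v) \<Rightarrow> bool" where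
  "internal_sequence U n s \<longleftrightarrow>
     (\<exists>g. internal U g \<and>
          (\<forall>p. imem U p g \<longrightarrow> (\<exists>i. (i, n) \<in> hyper_le U \<and> is_pair (imem U) p i (s i))) \<and>
          (\<forall>i. (i, n) \<in> hyper_le U \<longrightarrow> (\<exists>p. imem U p g \<and> is_pair (imem U) p i (s i))))"


section \<open>Coarse spaces\<close>

definition coarse_structure :: "'a set \<Rightarrow> ('a \<times> 'a) set set \<Rightarrow> bool" where
  "coarse_structure X C \<longleftrightarrow>
     C \<subseteq> Pow (X \<times> X) \<and>
     Id_on X \<in> C \<and>
     (\<forall>E\<in>C. \<forall>F. F \<subseteq> E \<longrightarrow> F \<in> C) \<and>
     (\<forall>E\<in>C. \<forall>F\<in>C. E \<union> F \<in> C) \<and>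
     (\<forall>E\<in>C. \<forall>F\<in>C. E O F \<in> C) \<and>
     (\<forall>E\<in>C. E\<inverse> \<in> C)"

definition pointed_coarse_space :: "'a set \<Rightarrow> ('a \<times> 'a) set set \<Rightarrow> 'a \<Rightarrow> bool" where
  "pointed_coarse_space X C \<xi> \<longleftrightarrow> coarse_structure X C \<and> \<xi> \<in> X"

definition bounded_at :: "'a set \<Rightarrow> ('a \<times> 'a) set set \<Rightarrow> 'a \<Rightarrow> 'a set set" where
  "bounded_at X C \<xi> = {B. B \<subseteq> X \<and> B \<times> B \<in> C \<and> \<xi> \<in> B}"

text \<open>
  The intersection with \<open>A \<times> A\<close> outside the power only affects exponent 0,
  where it turns \<open>Id\<close> into the diagonal of \<open>A\<close>.
\<close>

definition connected_by :: "('a \<times> 'a) set \<Rightarrow> 'a set \<Rightarrow> bool" where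
  "connected_by E A \<longleftrightarrow> A \<times> A = (\<Union>n::nat. ((E \<inter> A \<times> A) ^^ n) \<inter> A \<times> A)"

definition non_scattering :: "'a set \<Rightarrow> ('a \<times> 'a) set set \<Rightarrow> 'a \<Rightarrow> bool" where
  "non_scattering X C \<xi> \<longleftrightarrow>
     (\<exists>E\<in>C. \<forall>A\<in>bounded_at X C \<xi>. \<exists>B\<in>bounded_at X C \<xi>. A \<subseteq> B \<and> connected_by E (X - B))"


section \<open>The nonstandard invariant\<close>

definition finitely_close :: "('u, 'v) universe \<Rightarrow> ('u \<times> 'u) set set \<Rightarrow> 'v \<Rightarrow> 'v \<Rightarrow> bool" where
  "finitely_close U C x y \<longleftrightarrow> (\<exists>E\<in>C. (x, y) \<in> star_rel U E)"

definition FIN_pts :: "('u, 'v) universe \<Rightarrow> 'u set \<Rightarrow> ('u \<times> 'u) set set \<Rightarrow> 'u \<Rightarrow> 'v set" where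
  "FIN_pts U X C \<xi> = {x \<in> star_set U X. finitely_close U C x (star U \<xi>)}"

definition INF_pts :: "('u, 'v) universe \<Rightarrow> 'u set \<Rightarrow> ('u \<times> 'u) set set \<Rightarrow> 'u \<Rightarrow> 'v set" where
  "INF_pts U X C \<xi> = star_set U X - FIN_pts U X C \<xi>"

definition iota_rel ::
  "('u, 'v) universe \<Rightarrow> 'u set \<Rightarrow> ('u \<times> 'u) set set \<Rightarrow> 'u \<Rightarrow> ('v \<times> 'v) set" where
  "iota_rel U X C \<xi> =
     {(x, y). x \<in> INF_pts U X C \<xi> \<and> y \<in> INF_pts U X C \<xi> \<and>
        (\<exists>n\<in>hypernats U. \<exists>s.
           internal_sequence U n s \<and>
           (\<forall>i. (i, n) \<in> hyper_le U \<longrightarrow> s i \<in> INF_pts U X C \<xi>) \<and>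
           s (star U (num U 0)) = x \<and>
           s n = y \<and>
           (\<forall>i j. (i, n) \<in> hyper_less U \<and> (i, j) \<in> hyper_suc U
                    \<longrightarrow> finitely_close U C (s i) (s j)))}"

definition iota ::
  "('u, 'v) universe \<Rightarrow> 'u set \<Rightarrow> ('u \<times> 'u) set set \<Rightarrow> 'u \<Rightarrow> 'v set set" where
  "iota U X C \<xi> = INF_pts U X C \<xi> // iota_rel U X C \<xi>"

end

theory Submission imports Defs begin

text \<open>
  Any two infinite points \<open>x\<close> and \<open>y\<close> are equivalent, so that \<open>INF_pts\<close> is the only
  possible class.  Let \<open>E\<close> witness that the space is non-scattering at infinity.  For a
  bounded set \<open>A\<close> containing the base point, consider the internal set of all members \<open>B\<close>
  of the extension of
    \<open>{B. B is bounded, A \<subseteq> B, X - B is E-connected}\<close>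
  that contain neither \<open>x\<close> nor \<open>y\<close>.  These internal sets have the finite intersection
  property: finitely many bounded sets \<open>A\<close> lie in one bounded set \<open>B\<close> with \<open>E\<close>-connected
  complement, and the extension of \<open>B\<close> consists of finite points.  By saturation there is
  one internal \<open>b\<close> in all of them (\<open>internal_bounded_set\<close>).  It contains the extension of
  every bounded \<open>A\<close>, hence every finite point (\<open>FIN_pts_eq\<close>).

  In the standard universe, two points outside a set with \<open>E\<close>-connected complement are
  joined by a finite \<open>E\<close>-chain outside it.  The graph of the chain is a set, and being such
  a graph is a bounded formula, so that transfer yields an internal hyperfinite \<open>E\<close>-chain
  from \<open>x\<close> to \<open>y\<close> outside \<open>b\<close> (\<open>internal_path\<close>).  All its points are infinite because \<open>b\<close>
  contains the finite ones, and consecutive points are finitely close because \<open>E\<close> is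
  controlled.
\<close>

section \<open>Derived bounded formulas\<close>

definition Disj :: "fm \<Rightarrow> fm \<Rightarrow> fm" where
  "Disj \<phi> \<psi> = Neg (Conj (Neg \<phi>) (Neg \<psi>))"

definition Imp :: "fm \<Rightarrow> fm \<Rightarrow> fm" where
  "Imp \<phi> \<psi> = Neg (Conj \<phi> (Neg \<psi>))"

definition BEx :: "nat \<Rightarrow> nat \<Rightarrow> fm \<Rightarrow> fm" where
  "BEx i j \<phi> = Neg (BAll i j (Neg \<phi>))"

lemma sat_derived [simp]:
  "sat R (Disj \<phi> \<psi>) e \<longleftrightarrow> sat R \<phi> e \<or> sat R \<psi> e"
  "sat R (Imp \<phi> \<psi>) e \<longleftrightarrow> (sat R \<phi> e \<longrightarrow> sat R \<psi> e)"
  "sat R (BEx i j \<phi>) e \<longleftrightarrow> (\<exists>z. R z (e j) \<and> sat R \<phi> (e(i := z)))"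
  by (auto simp: Disj_def Imp_def BEx_def)

text \<open>
  The predicate \<^const>\<open>is_pair\<close> as a bounded formula: its two witnesses are elements of
  the pair.  The variables 100, 101 and 102 are reserved for the bound variables.
\<close>

definition PairF :: "nat \<Rightarrow> nat \<Rightarrow> nat \<Rightarrow> fm" where
  "PairF p x y =
     BEx 100 p (BEx 101 p
       (Conj (BAll 102 p (Disj (Eq 102 100) (Eq 102 101)))
       (Conj (Conj (Mem x 100) (BAll 102 100 (Eq 102 x)))
             (Conj (Conj (Mem x 101) (Mem y 101))
                   (BAll 102 101 (Disj (Eq 102 x) (Eq 102 y)))))))"

lemma sat_PairF [simp]:
  assumes "p < 100" "x < 100" "y < 100"
  shows "sat R (PairF p x y) e \<longleftrightarrow> is_pair R (e p) (e x) (e y)"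
proof -
  have "p \<notin> {100, 101, 102}" "x \<notin> {100, 101, 102}" "y \<notin> {100, 101, 102}"
    using assms by auto
  then show ?thesis
    unfolding PairF_def is_pair_def by simp blast
qed

text \<open>
  The variables \<open>v\<^sub>x\<close> and \<open>v\<^sub>y\<close> are related by the set of pairs \<open>v\<^sub>r\<close>.  The bound variable
  for the pair is 99.
\<close>

definition RelF :: "nat \<Rightarrow> nat \<Rightarrow> nat \<Rightarrow> fm" where
  "RelF r x y = BEx 99 r (PairF 99 x y)"

lemma sat_RelF [simp]:
  assumes "x < 99" "y < 99"
  shows "sat R (RelF r x y) e \<longleftrightarrow> (\<exists>p. R p (e r) \<and> is_pair R p (e x) (e y))"
  using assms by (simp add: RelF_def)

lemma is_pair_inject:
  assumes "is_pair R p x y" "is_pair R p x' y'"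
  shows "x = x' \<and> y = y'"
proof -
  obtain a b where ab: "\<And>z. R z p \<longleftrightarrow> z = a \<or> z = b" "\<And>z. R z a \<longleftrightarrow> z = x"
    "\<And>z. R z b \<longleftrightarrow> z = x \<or> z = y"
    using assms(1) unfolding is_pair_def by blast
  obtain a' b' where ab': "\<And>z. R z p \<longleftrightarrow> z = a' \<or> z = b'" "\<And>z. R z a' \<longleftrightarrow> z = x'"
    "\<And>z. R z b' \<longleftrightarrow> z = x' \<or> z = y'"
    using assms(2) unfolding is_pair_def by blast
  have x: "x = x'" using ab ab' by metis
  have "y = y'" using ab ab' x by metis
  with x show ?thesis by simp
qed


section \<open>Sets, pairs and relations in a nonstandard universe\<close>

text \<open>The standard object that represents the relation \<open>E\<close> as a set of Kuratowski pairs.\<close>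

definition rel_code :: "('u, 'v) universe \<Rightarrow> ('u \<times> 'u) set \<Rightarrow> 'u" where
  "rel_code U E = code U {q. \<exists>(a, b)\<in>E. is_pair (smem U) q a b}"

text \<open>
  The Kuratowski pair as a function on the standard universe, where pairs exist and are
  unique by pairing and extensionality.
\<close>

definition kpair :: "('u, 'v) universe \<Rightarrow> 'u \<Rightarrow> 'u \<Rightarrow> 'u" where
  "kpair U x y = (THE p. is_pair (smem U) p x y)"

lemma imem_star_code [simp]: "imem U x (star U (code U A)) \<longleftrightarrow> x \<in> star_set U A"
  by (simp add: star_set_def)

lemma pair_in_star_rel_code [simp]:
  "(\<exists>p. imem U p (star U (rel_code U E)) \<and> is_pair (imem U) p x y) \<longleftrightarrow> (x, y) \<in> star_rel U E"
  by (auto simp: star_rel_def rel_code_def)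

context nonstandard_universe
begin

lemma setp_code: "small U A \<Longrightarrow> setp U (code U A)"
  and elts_code: "small U A \<Longrightarrow> elts U (code U A) = A"
proof -
  assume "small U A"
  then obtain a where a: "setp U a \<and> elts U a = A" by (auto simp: small_def)
  have "setp U (code U A) \<and> elts U (code U A) = A"
    unfolding code_def by (rule theI[of _ a]) (use a extensionality in blast)+
  then show "setp U (code U A)" "elts U (code U A) = A" by auto
qed

lemma smem_code [simp]: "small U A \<Longrightarrow> smem U x (code U A) \<longleftrightarrow> x \<in> A"
  using elts_code[of A] by (auto simp: elts_def)

lemma small_singleton: "small U {x}"
  using small_pair[of x x] by simp

lemma small_Un:
  assumes "small U A" "small U B"
  shows "small U (A \<union> B)"
  using small_Union[OF small_pair[of "code U A" "code U B"]] assms by (simp add: elts_code)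

lemma is_pair_kpair: "is_pair (smem U) p x y \<longleftrightarrow> p = kpair U x y"
proof -
  define a where "a = code U {x, x}"
  define b where "b = code U {x, y}"
  define k where "k = code U {a, b}"
  have k: "is_pair (smem U) k x y"
    unfolding is_pair_def
    by (rule exI[of _ a], rule exI[of _ b]) (simp add: k_def a_def b_def small_pair small_singleton)
  have setpI: "setp U c" if "smem U z c" for z c
    using that smem_setp by blast
  have eqI: "c = d" if "\<And>z. smem U z c \<longleftrightarrow> smem U z d" "smem U w c" for c d w
    using that by (intro extensionality setpI) (auto simp: elts_def)
  have uniq: "q = k" if q: "is_pair (smem U) q x y" for q
  proof -
    obtain c d where cd: "\<And>z. smem U z q \<longleftrightarrow> z = c \<or> z = d" "\<And>z. smem U z c \<longleftrightarrow> z = x"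
      "\<And>z. smem U z d \<longleftrightarrow> z = x \<or> z = y"
      using q unfolding is_pair_def by blast
    have "c = a" by (rule eqI[of _ _ x]) (auto simp: cd a_def small_singleton)
    moreover have "d = b" by (rule eqI[of _ _ x]) (auto simp: cd b_def small_pair)
    ultimately show "q = k" by (intro eqI[of _ _ c]) (auto simp: cd k_def small_pair)
  qed
  have "kpair U x y = k"
    unfolding kpair_def using k uniq by (rule the_equality)
  with k uniq show ?thesis by metis
qed

lemma kpair_inject [simp]: "kpair U x y = kpair U x' y' \<longleftrightarrow> x = x' \<and> y = y'"
  using is_pair_inject is_pair_kpair by metis

lemma small_pairs:
  assumes "small U A" "small U B" "E \<subseteq> A \<times> B"
  shows "small U {q. \<exists>(a, b)\<in>E. is_pair (smem U) q a b}"
proof (rule small_subset)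
  let ?P = "\<lambda>A. {b. setp U b \<and> elts U b \<subseteq> A}"
  show "small U (?P (?P (A \<union> B)))"
    by (intro small_Pow small_Un assms)
  have "q \<in> ?P (?P (A \<union> B))" if q: "is_pair (smem U) q a b" and "(a, b) \<in> E" for q a b
  proof -
    obtain c d where cd: "\<And>z. smem U z q \<longleftrightarrow> z = c \<or> z = d" "\<And>z. smem U z c \<longleftrightarrow> z = a"
      "\<And>z. smem U z d \<longleftrightarrow> z = a \<or> z = b"
      using q unfolding is_pair_def by blast
    have "setp U q" "setp U c" "setp U d"
      using cd smem_setp by blast+
    then show ?thesis
      using that assms(3) by (auto simp: elts_def cd)
  qed
  then show "{q. \<exists>(a, b)\<in>E. is_pair (smem U) q a b} \<subseteq> ?P (?P (A \<union> B))"
    by blast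
qed

lemma pair_in_rel_code:
  assumes "small U A" "small U B" "E \<subseteq> A \<times> B"
  shows "(\<exists>p. smem U p (rel_code U E) \<and> is_pair (smem U) p x y) \<longleftrightarrow> (x, y) \<in> E"
  using small_pairs[OF assms] by (auto simp: rel_code_def is_pair_kpair)

lemma transfer:
  assumes "sat (smem U) \<phi> e"
  shows "sat (imem U) \<phi> (star U \<circ> e)"
  using assms transfer_principle by blast

lemma star_in_star_set:
  assumes "small U A" "a \<in> A"
  shows "star U a \<in> star_set U A"
  using transfer[of "Mem 0 1" "(\<lambda>_. a)(1 := code U A)"] assms by simp

lemma star_rel_subset:
  assumes "small U A" "small U B" "E \<subseteq> A \<times> B" "(x, y) \<in> star_rel U E"
  shows "x \<in> star_set U A" "y \<in> star_set U B"
proof -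
  have "sat (smem U) (BAll 0 1 (BEx 2 3 (BEx 4 5 (PairF 0 2 4))))
    ((\<lambda>_. undefined)(1 := rel_code U E, 3 := code U A, 5 := code U B))"
    using assms(1-3) small_pairs[OF assms(1-3)] by (fastforce simp: rel_code_def)
  from transfer[OF this] have *: "\<exists>a \<in> star_set U A. \<exists>b \<in> star_set U B. is_pair (imem U) p a b"
    if "imem U p (star U (rel_code U E))" for p
    using that by simp blast
  obtain p where "imem U p (star U (rel_code U E))" "is_pair (imem U) p x y"
    using assms(4) pair_in_star_rel_code by metis
  with * is_pair_inject show "x \<in> star_set U A" "y \<in> star_set U B"
    by metis+
qed

end


section \<open>Paths that avoid a set\<close>

text \<open>
  With respect to the membership relation \<open>R\<close>, the set \<open>g\<close> is the graph of a sequence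
  \<open>{s i}\<^sub>i\<^sub>\<le>\<^sub>n\<close> in \<open>X - b\<close> from \<open>x\<close> to \<open>y\<close> whose steps lie in \<open>E\<close>.  All objects that
  depend on the universe are parameters, so that the same definition can be read in the
  standard and in the nonstandard universe.
\<close>

definition is_path ::
  "('m \<Rightarrow> 'm \<Rightarrow> bool) \<Rightarrow> 'm set \<Rightarrow> ('m \<times> 'm) set \<Rightarrow> ('m \<times> 'm) set \<Rightarrow> ('m \<times> 'm) set \<Rightarrow> 'm
   \<Rightarrow> 'm set \<Rightarrow> ('m \<times> 'm) set \<Rightarrow> 'm \<Rightarrow> 'm \<Rightarrow> 'm \<Rightarrow> 'm \<Rightarrow> 'm \<Rightarrow> bool" where
  "is_path R N le lt sc zero X E b x y n g \<longleftrightarrow>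
     (\<forall>p. R p g \<longrightarrow> (\<exists>i\<in>N. \<exists>u\<in>X. is_pair R p i u \<and> (i, n) \<in> le \<and> \<not> R u b)) \<and>
     (\<forall>i\<in>N. (i, n) \<in> le \<longrightarrow> (\<exists>p. R p g \<and> (\<exists>u\<in>X. is_pair R p i u))) \<and>
     (\<forall>p. R p g \<longrightarrow> (\<forall>q. R q g \<longrightarrow>
        (\<forall>i\<in>N. \<forall>u\<in>X. \<forall>v\<in>X. is_pair R p i u \<longrightarrow> is_pair R q i v \<longrightarrow> u = v))) \<and>
     (\<exists>p. R p g \<and> is_pair R p zero x) \<and>
     (\<exists>p. R p g \<and> is_pair R p n y) \<and>
     (\<forall>i\<in>N. \<forall>j\<in>N. (i, n) \<in> lt \<longrightarrow> (i, j) \<in> sc \<longrightarrow>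
        (\<exists>p. R p g \<and> (\<exists>q. R q g \<and>
           (\<exists>u\<in>X. \<exists>v\<in>X. is_pair R p i u \<and> is_pair R q j v \<and> (u, v) \<in> E))))"

text \<open>
  The variables 0 to 4 stand for \<open>b\<close>, \<open>x\<close>, \<open>y\<close>, \<open>n\<close>, \<open>g\<close>, and 20 to 26 for \<open>N\<close>, \<open>le\<close>, \<open>lt\<close>,
  \<open>sc\<close>, \<open>zero\<close>, \<open>X\<close>, \<open>E\<close>.
\<close>

definition PathF :: fm where
  "PathF =
     Conj (BAll 5 4 (BEx 6 20 (BEx 7 25
             (Conj (PairF 5 6 7) (Conj (RelF 21 6 3) (Neg (Mem 7 0)))))))
    (Conj (BAll 6 20 (Imp (RelF 21 6 3) (BEx 5 4 (BEx 7 25 (PairF 5 6 7)))))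
    (Conj (BAll 5 4 (BAll 8 4 (BAll 6 20 (BAll 7 25 (BAll 10 25
             (Imp (PairF 5 6 7) (Imp (PairF 8 6 10) (Eq 7 10))))))))
    (Conj (BEx 5 4 (PairF 5 24 1))
    (Conj (BEx 5 4 (PairF 5 3 2))
          (BAll 6 20 (BAll 9 20 (Imp (RelF 22 6 3) (Imp (RelF 23 6 9)
             (BEx 5 4 (BEx 8 4 (BEx 7 25 (BEx 10 25
               (Conj (PairF 5 6 7) (Conj (PairF 8 9 10) (RelF 26 7 10)))))))))))))))"

lemma sat_PathF:
  "sat R PathF e \<longleftrightarrow>
     is_path R {i. R i (e 20)}
       {(i, j). \<exists>p. R p (e 21) \<and> is_pair R p i j} {(i, j). \<exists>p. R p (e 22) \<and> is_pair R p i j}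
       {(i, j). \<exists>p. R p (e 23) \<and> is_pair R p i j} (e 24)
       {u. R u (e 25)} {(u, v). \<exists>p. R p (e 26) \<and> is_pair R p u v}
       (e 0) (e 1) (e 2) (e 3) (e 4)"
  unfolding PathF_def is_path_def Ball_def Bex_def
  by (simp del: One_nat_def ex_simps all_simps imp_conjL)

context nonstandard_universe
begin

abbreviation nums :: "'u set" where
  "nums \<equiv> range (num U)"

text \<open>The orderings and the successor relation on the standard numerals.\<close>

definition num_le :: "('u \<times> 'u) set" where
  "num_le = {(num U m, num U k) | m k. m \<le> k}"

definition num_less :: "('u \<times> 'u) set" where
  "num_less = {(num U m, num U k) | m k. m < k}"

definition num_suc :: "('u \<times> 'u) set" where
  "num_suc = {(num U m, num U (Suc m)) | m. True}"

lemmas num_rel_defs = num_le_def num_less_def num_suc_def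

lemma num_rel_subset:
  "num_le \<subseteq> nums \<times> nums" "num_less \<subseteq> nums \<times> nums" "num_suc \<subseteq> nums \<times> nums"
  by (auto simp: num_rel_defs)

lemma hyper_rel_eq:
  "hyper_le U = star_rel U num_le" "hyper_less U = star_rel U num_less"
  "hyper_suc U = star_rel U num_suc"
  by (simp_all add: hyper_le_def hyper_less_def hyper_suc_def num_rel_defs)

lemma num_eq [simp]: "num U m = num U k \<longleftrightarrow> m = k"
  using inj_num by (auto dest: injD)

text \<open>
  The standard sets of pairs between numerals and elements of \<open>X\<close>.  They form a small set,
  over which the existence of a path can be quantified by a bounded formula.
\<close>

definition graphs :: "'u set \<Rightarrow> 'u set" where
  "graphs X = {g. setp U g \<and>
     elts U g \<subseteq> {q. \<exists>(a, b) \<in> nums \<times> X. is_pair (smem U) q a b}}"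

lemma small_graphs: "small U X \<Longrightarrow> small U (graphs X)"
  unfolding graphs_def by (intro small_Pow small_pairs[OF small_num _ order_refl])

text \<open>A finite chain in the relation \<open>E\<close> restricted to the complement of \<open>b\<close> has a graph.\<close>

lemma standard_path:
  assumes X: "small U X"
    and conn: "connected_by E (X - elts U b)"
    and xy: "x \<in> X - elts U b" "y \<in> X - elts U b"
  shows "\<exists>n\<in>nums. \<exists>g\<in>graphs X.
           is_path (smem U) nums num_le num_less num_suc (num U 0) X E b x y n g"
proof -
  let ?A = "X - elts U b"
  have "(x, y) \<in> (\<Union>n::nat. ((E \<inter> ?A \<times> ?A) ^^ n) \<inter> ?A \<times> ?A)"
    using conn xy unfolding connected_by_def by blast
  then obtain n where "(x, y) \<in> (E \<inter> ?A \<times> ?A) ^^ n"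
    by blast
  then obtain f where f: "f 0 = x" "f n = y" "\<And>i. i < n \<Longrightarrow> (f i, f (Suc i)) \<in> E \<inter> ?A \<times> ?A"
    unfolding relpow_fun_conv by auto
  have fA: "f i \<in> ?A" if "i \<le> n" for i
    using that f xy by (cases "i = n") auto
  define G where "G = {kpair U (num U i) (f i) | i. i \<le> n}"
  have sub: "G \<subseteq> {q. \<exists>(a, b) \<in> nums \<times> X. is_pair (smem U) q a b}"
    using fA by (auto simp: G_def is_pair_kpair)
  have small_G: "small U G"
    by (rule small_subset[OF small_pairs[OF small_num X order_refl] sub])
  have step: "\<exists>p. p \<in> G \<and> (\<exists>q. q \<in> G \<and> (\<exists>u\<in>X. \<exists>v\<in>X.
      p = kpair U (num U i) u \<and> q = kpair U (num U (Suc i)) v \<and> (u, v) \<in> E))" if "i < n" for i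
  proof (intro exI conjI bexI)
    show "kpair U (num U i) (f i) \<in> G" "kpair U (num U (Suc i)) (f (Suc i)) \<in> G"
      using that by (auto simp: G_def)
    show "(f i, f (Suc i)) \<in> E" "f i \<in> X" "f (Suc i) \<in> X"
      using f(3)[OF that] by auto
  qed (rule refl)+
  have "is_path (smem U) nums num_le num_less num_suc (num U 0) X E b x y (num U n) (code U G)"
    unfolding is_path_def is_pair_kpair smem_code[OF small_G]
  proof (intro conjI)
    show "\<forall>i\<in>nums. \<forall>j\<in>nums. (i, num U n) \<in> num_less \<longrightarrow> (i, j) \<in> num_suc \<longrightarrow>
      (\<exists>p. p \<in> G \<and> (\<exists>q. q \<in> G \<and> (\<exists>u\<in>X. \<exists>v\<in>X.
        p = kpair U i u \<and> q = kpair U j v \<and> (u, v) \<in> E)))"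
      using step by (simp add: num_rel_defs)
  qed (use fA f(1,2) in \<open>auto simp: G_def num_rel_defs elts_def\<close>)
  moreover have "code U G \<in> graphs X"
    using sub small_G by (auto simp: graphs_def setp_code elts_code)
  ultimately show ?thesis by blast
qed

text \<open>
  The transfer of \<open>standard_path\<close>: if every member of \<open>K\<close> has an \<open>E\<close>-connected complement,
  then any two points outside a member of the extension of \<open>K\<close> are joined by an internal
  hyperfinite path outside it.
\<close>

lemma internal_path:
  assumes X: "small U X" and E: "E \<subseteq> X \<times> X" and K: "small U K"
    and conn: "\<And>b. b \<in> K \<Longrightarrow> connected_by E (X - elts U b)"
    and b: "b \<in> star_set U K"
    and xy: "x \<in> star_set U X" "y \<in> star_set U X" "\<not> imem U x b" "\<not> imem U y b"
  shows "\<exists>n\<in>hypernats U. \<exists>g. internal U g \<and>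
           is_path (imem U) (hypernats U) (hyper_le U) (hyper_less U) (hyper_suc U)
             (star U (num U 0)) (star_set U X) (star_rel U E) b x y n g"
proof -
  define e where "e = (\<lambda>_::nat. undefined :: 'u)(20 := code U nums, 21 := rel_code U num_le,
    22 := rel_code U num_less, 23 := rel_code U num_suc, 24 := num U 0, 25 := code U X,
    26 := rel_code U E, 30 := code U K, 31 := code U (graphs X))"
  define \<phi> where "\<phi> = BAll 0 30 (BAll 1 25 (BAll 2 25 (Imp (Neg (Mem 1 0)) (Imp (Neg (Mem 2 0))
    (BEx 3 20 (BEx 4 31 PathF))))))"
  have "sat (smem U) \<phi> e"
    unfolding \<phi>_def e_def
    using standard_path[OF X conn]
    by (simp add: sat_PathF K X small_num small_graphs
        pair_in_rel_code[OF small_num small_num num_rel_subset(1)]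
        pair_in_rel_code[OF small_num small_num num_rel_subset(2)]
        pair_in_rel_code[OF small_num small_num num_rel_subset(3)]
        pair_in_rel_code[OF X X E] elts_def Bex_def)
  from transfer[OF this] obtain n g where "n \<in> hypernats U" "g \<in> star_set U (graphs X)"
    "is_path (imem U) (hypernats U) (hyper_le U) (hyper_less U) (hyper_suc U)
       (star U (num U 0)) (star_set U X) (star_rel U E) b x y n g"
    unfolding \<phi>_def e_def using b xy
    by (simp add: sat_PathF hypernats_def hyper_rel_eq) blast
  moreover have "internal U g"
    using \<open>g \<in> _\<close> setp_code[OF small_graphs[OF X]] unfolding internal_def star_set_def by auto
  ultimately show ?thesis by blast
qed

lemma hyper_le_hypernats: "(i, n) \<in> hyper_le U \<Longrightarrow> i \<in> hypernats U"
  unfolding hyper_rel_eq hypernats_def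
  by (rule star_rel_subset(1)[OF small_num small_num num_rel_subset(1)])

lemma hyper_less_hypernats: "(i, n) \<in> hyper_less U \<Longrightarrow> i \<in> hypernats U"
  unfolding hyper_rel_eq hypernats_def
  by (rule star_rel_subset(1)[OF small_num small_num num_rel_subset(2)])

lemma hyper_suc_hypernats: "(i, n) \<in> hyper_suc U \<Longrightarrow> n \<in> hypernats U"
  unfolding hyper_rel_eq hypernats_def
  by (rule star_rel_subset(2)[OF small_num small_num num_rel_subset(3)])

text \<open>The graph read as a sequence, in the form used by \<^const>\<open>iota_rel\<close>.\<close>

lemma sequence_of_path:
  assumes path: "is_path (imem U) (hypernats U) (hyper_le U) (hyper_less U) (hyper_suc U)
             (star U (num U 0)) (star_set U X) (star_rel U E) b x y n g"
    and g: "internal U g"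
  obtains s where "internal_sequence U n s"
    "\<And>i. (i, n) \<in> hyper_le U \<Longrightarrow> s i \<in> star_set U X \<and> \<not> imem U (s i) b"
    "s (star U (num U 0)) = x" "s n = y"
    "\<And>i j. (i, n) \<in> hyper_less U \<Longrightarrow> (i, j) \<in> hyper_suc U \<Longrightarrow> (s i, s j) \<in> star_rel U E"
proof -
  define s where "s i = (SOME u. \<exists>p. imem U p g \<and> is_pair (imem U) p i u)" for i
  have dom: "\<exists>i\<in>hypernats U. \<exists>u\<in>star_set U X. is_pair (imem U) p i u \<and> (i, n) \<in> hyper_le U \<and> \<not> imem U u b"
    if "imem U p g" for p
    using path that unfolding is_path_def by blast
  have mem: "i \<in> hypernats U \<and> (i, n) \<in> hyper_le U \<and> u \<in> star_set U X \<and> \<not> imem U u b"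
    if "imem U p g" "is_pair (imem U) p i u" for p i u
    using dom[OF that(1)] is_pair_inject[OF that(2)] by metis
  have fn: "u = v" if "imem U p g" "is_pair (imem U) p i u" "imem U q g" "is_pair (imem U) q i v"
    for p q i u v
  proof -
    have "\<forall>p. imem U p g \<longrightarrow> (\<forall>q. imem U q g \<longrightarrow>
        (\<forall>i\<in>hypernats U. \<forall>u\<in>star_set U X. \<forall>v\<in>star_set U X.
           is_pair (imem U) p i u \<longrightarrow> is_pair (imem U) q i v \<longrightarrow> u = v))"
      using path unfolding is_path_def by (elim conjE)
    then show ?thesis
      using that mem[OF that(1,2)] mem[OF that(3,4)] by blast
  qed
  have val: "s i = u" if "imem U p g" "is_pair (imem U) p i u" for p i u
    unfolding s_def by (rule some_equality) (use that fn in blast)+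
  have total: "\<exists>p u. imem U p g \<and> is_pair (imem U) p i u" if "(i, n) \<in> hyper_le U" for i
    using path that hyper_le_hypernats[OF that] unfolding is_path_def by blast
  show thesis
  proof (rule that[of s])
    show "internal_sequence U n s"
      unfolding internal_sequence_def
    proof (rule exI[of _ g], intro conjI allI impI g)
      show "\<exists>i. (i, n) \<in> hyper_le U \<and> is_pair (imem U) p i (s i)" if "imem U p g" for p
        using dom[OF that] val[OF that] by metis
      show "\<exists>p. imem U p g \<and> is_pair (imem U) p i (s i)" if "(i, n) \<in> hyper_le U" for i
        using total[OF that] val by metis
    qed
    show "s i \<in> star_set U X \<and> \<not> imem U (s i) b" if "(i, n) \<in> hyper_le U" for i
      using total[OF that] val mem by metis
    show "s (star U (num U 0)) = x" "s n = y"
      using path val unfolding is_path_def by blast+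
    show "(s i, s j) \<in> star_rel U E" if ij: "(i, n) \<in> hyper_less U" "(i, j) \<in> hyper_suc U" for i j
    proof -
      obtain p q u v where "imem U p g" "imem U q g" "is_pair (imem U) p i u"
        "is_pair (imem U) q j v" "(u, v) \<in> star_rel U E"
        using path ij hyper_less_hypernats[OF ij(1)] hyper_suc_hypernats[OF ij(2)]
        unfolding is_path_def by meson
      then show ?thesis using val by metis
    qed
  qed
qed

end


section \<open>Bounded sets\<close>

lemma bounded_at_Un:
  assumes "coarse_structure X C" "A \<in> bounded_at X C \<xi>" "B \<in> bounded_at X C \<xi>"
  shows "A \<union> B \<in> bounded_at X C \<xi>"
proof -
  have AB: "A \<times> A \<in> C" "B \<times> B \<in> C" "\<xi> \<in> A" "\<xi> \<in> B"
    using assms by (auto simp: bounded_at_def)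
  \<comment> \<open>The base point lies in both sets, so that the composition is the whole product.\<close>
  have "(A \<times> A) O (B \<times> B) = A \<times> B" "(B \<times> B) O (A \<times> A) = B \<times> A"
    using AB by auto
  moreover have "(A \<times> A) O (B \<times> B) \<in> C" "(B \<times> B) O (A \<times> A) \<in> C"
    using assms(1) AB unfolding coarse_structure_def by blast+
  moreover have "(A \<union> B) \<times> (A \<union> B) = (A \<times> A \<union> B \<times> B) \<union> (A \<times> B \<union> B \<times> A)"
    by auto
  ultimately have "(A \<union> B) \<times> (A \<union> B) \<in> C"
    using assms(1) AB unfolding coarse_structure_def by metis
  then show ?thesis using assms by (auto simp: bounded_at_def)
qed

lemma bounded_at_singleton:
  assumes "pointed_coarse_space X C \<xi>"
  shows "{\<xi>} \<in> bounded_at X C \<xi>"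
proof -
  have "Id_on X \<in> C" "{\<xi>} \<times> {\<xi>} \<subseteq> Id_on X"
    using assms by (auto simp: pointed_coarse_space_def coarse_structure_def)
  then have "{\<xi>} \<times> {\<xi>} \<in> C"
    using assms unfolding pointed_coarse_space_def coarse_structure_def by blast
  then show ?thesis
    using assms by (auto simp: bounded_at_def pointed_coarse_space_def)
qed

lemma bounded_at_finite_Union:
  assumes "pointed_coarse_space X C \<xi>" "finite \<A>" "\<A> \<subseteq> bounded_at X C \<xi>"
  shows "\<exists>B\<in>bounded_at X C \<xi>. \<Union>\<A> \<subseteq> B"
  using assms(2,3)
proof (induction \<A>)
  case empty
  then show ?case using bounded_at_singleton[OF assms(1)] by blast
next
  case (insert A \<A>)
  then obtain B where "B \<in> bounded_at X C \<xi>" "\<Union>\<A> \<subseteq> B"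
    by auto
  moreover have "A \<union> B \<in> bounded_at X C \<xi>"
    using assms(1) insert.prems calculation(1)
    by (intro bounded_at_Un) (auto simp: pointed_coarse_space_def)
  ultimately show ?case
    by (intro bexI[of _ "A \<union> B"]) auto
qed

lemma bounded_at_section:
  assumes "pointed_coarse_space X C \<xi>" "F \<in> C"
  shows "insert \<xi> {a. (a, \<xi>) \<in> F} \<in> bounded_at X C \<xi>" (is "?A \<in> _")
proof -
  \<comment> \<open>The diagonal is added because \<open>(\<xi>, \<xi>)\<close> need not belong to \<open>F\<close>.\<close>
  let ?F = "F \<union> Id_on X"
  have cs: "coarse_structure X C" "\<xi> \<in> X"
    using assms(1) by (auto simp: pointed_coarse_space_def)
  have "?F \<in> C" using cs assms(2) unfolding coarse_structure_def by blast
  then have "?F\<inverse> \<in> C" using cs unfolding coarse_structure_def by blast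
  then have "?F O ?F\<inverse> \<in> C" using cs \<open>?F \<in> C\<close> unfolding coarse_structure_def by blast
  moreover have "?A \<times> ?A \<subseteq> ?F O ?F\<inverse>" using cs by auto
  ultimately have "?A \<times> ?A \<in> C" using cs unfolding coarse_structure_def by blast
  moreover have "F \<subseteq> X \<times> X" using cs assms(2) by (auto simp: coarse_structure_def)
  with cs have "?A \<subseteq> X" by blast
  ultimately show ?thesis by (simp add: bounded_at_def)
qed

context nonstandard_universe
begin

text \<open>The finite points are the points of the extensions of the bounded sets.\<close>

lemma FIN_pts_eq:
  assumes X: "small U X" and pcs: "pointed_coarse_space X C \<xi>"
  shows "FIN_pts U X C \<xi> = (\<Union>A\<in>bounded_at X C \<xi>. star_set U A)"
proof (intro equalityI subsetI)
  fix x
  assume "x \<in> FIN_pts U X C \<xi>"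
  then obtain F where x: "x \<in> star_set U X" and F: "F \<in> C" "(x, star U \<xi>) \<in> star_rel U F"
    by (auto simp: FIN_pts_def finitely_close_def)
  let ?A = "insert \<xi> {a. (a, \<xi>) \<in> F}"
  have A: "?A \<in> bounded_at X C \<xi>" by (rule bounded_at_section[OF pcs F(1)])
  then have small_A: "small U ?A"
    by (intro small_subset[OF X]) (simp add: bounded_at_def)
  have FX: "F \<subseteq> X \<times> X"
    using pcs F(1) by (auto simp: pointed_coarse_space_def coarse_structure_def)
  have "sat (smem U) (BAll 0 1 (Imp (RelF 2 0 3) (Mem 0 4)))
    ((\<lambda>_. undefined)(1 := code U X, 2 := rel_code U F, 3 := \<xi>, 4 := code U ?A))"
    by (simp add: X small_A pair_in_rel_code[OF X X FX])
  from transfer[OF this] have "x \<in> star_set U ?A"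
    using x F(2) by auto
  with A show "x \<in> (\<Union>A\<in>bounded_at X C \<xi>. star_set U A)" by blast
next
  fix x
  assume "x \<in> (\<Union>A\<in>bounded_at X C \<xi>. star_set U A)"
  then obtain A where A: "A \<subseteq> X" "A \<times> A \<in> C" "\<xi> \<in> A" and x: "x \<in> star_set U A"
    by (auto simp: bounded_at_def)
  have small_A: "small U A" by (rule small_subset[OF X A(1)])
  have "sat (smem U) (BAll 0 1 (Conj (RelF 2 0 3) (Mem 0 4)))
    ((\<lambda>_. undefined)(1 := code U A, 2 := rel_code U (A \<times> A), 3 := \<xi>, 4 := code U X))"
    using A by (auto simp: X small_A pair_in_rel_code[OF small_A small_A order_refl])
  from transfer[OF this] have "(x, star U \<xi>) \<in> star_rel U (A \<times> A)" "x \<in> star_set U X"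
    using x by auto
  then show "x \<in> FIN_pts U X C \<xi>"
    using A by (auto simp: FIN_pts_def finitely_close_def)
qed

text \<open>
  An instance of the internal definition principle.  It transfers the separation axiom for
  subsets of \<open>K\<close> with the two parameters \<open>x\<close> and \<open>y\<close>.
\<close>

lemma internal_avoiding:
  assumes X: "small U X" and K: "small U K" and xy: "x \<in> star_set U X" "y \<in> star_set U X"
  shows "\<exists>F. internal U F \<and>
           (\<forall>b. imem U b F \<longleftrightarrow> b \<in> star_set U K \<and> \<not> imem U x b \<and> \<not> imem U y b)"
proof -
  let ?P = "{c. setp U c \<and> elts U c \<subseteq> K}"
  have P: "small U ?P" by (rule small_Pow[OF K])
  have ex: "\<exists>c. setp U c \<and> elts U c \<subseteq> K \<and> (\<forall>b. smem U b c \<longleftrightarrow> b \<in> K \<and> \<not> smem U u b \<and> \<not> smem U v b)"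
    for u v
  proof -
    have "small U {b \<in> K. \<not> smem U u b \<and> \<not> smem U v b}"
      by (rule small_subset[OF K]) auto
    then show ?thesis
      by (intro exI[of _ "code U {b \<in> K. \<not> smem U u b \<and> \<not> smem U v b}"])
        (auto simp: setp_code elts_code)
  qed
  have "sat (smem U)
    (BAll 0 1 (BAll 2 1 (BEx 3 4 (Conj
       (BAll 5 3 (Conj (Mem 5 6) (Conj (Neg (Mem 0 5)) (Neg (Mem 2 5)))))
       (BAll 5 6 (Imp (Conj (Neg (Mem 0 5)) (Neg (Mem 2 5))) (Mem 5 3)))))))
    ((\<lambda>_. undefined)(1 := code U X, 4 := code U ?P, 6 := code U K))"
    using ex by (simp add: X K P) blast
  from transfer[OF this] have "\<exists>F. F \<in> star_set U ?P \<and>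
      (\<forall>b. imem U b F \<longrightarrow> b \<in> star_set U K \<and> \<not> imem U x b \<and> \<not> imem U y b) \<and>
      (\<forall>b. b \<in> star_set U K \<longrightarrow> \<not> imem U x b \<and> \<not> imem U y b \<longrightarrow> imem U b F)"
    using xy by simp
  then obtain F where "F \<in> star_set U ?P"
    "\<And>b. imem U b F \<longleftrightarrow> b \<in> star_set U K \<and> \<not> imem U x b \<and> \<not> imem U y b"
    by blast
  moreover have "internal U F"
    using \<open>F \<in> _\<close> setp_code[OF P] unfolding internal_def star_set_def by auto
  ultimately show ?thesis by blast
qed

text \<open>
  Any two infinite points are avoided by an internal set that contains all finite points
  and belongs to the extension of a family of sets with \<open>E\<close>-connected complement.
\<close>

lemma internal_bounded_set:
  assumes X: "small U X" and pcs: "pointed_coarse_space X C \<xi>"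
    and cofinal: "\<forall>A\<in>bounded_at X C \<xi>. \<exists>B\<in>bounded_at X C \<xi>. A \<subseteq> B \<and> connected_by E (X - B)"
    and xy: "x \<in> INF_pts U X C \<xi>" "y \<in> INF_pts U X C \<xi>"
  obtains K b where "small U K" "\<And>b. b \<in> K \<Longrightarrow> connected_by E (X - elts U b)"
    "b \<in> star_set U K" "\<not> imem U x b" "\<not> imem U y b" "\<forall>z\<in>FIN_pts U X C \<xi>. imem U z b"
proof -
  \<comment> \<open>Bounded sets are represented by their codes, which form a standard index set.\<close>
  define I where "I = {a. setp U a \<and> elts U a \<in> bounded_at X C \<xi>}"
  define K where "K a = {b \<in> I. elts U a \<subseteq> elts U b \<and> connected_by E (X - elts U b)}" for a
  have small_I: "small U I"
    by (rule small_subset[OF small_Pow[OF X]]) (auto simp: I_def bounded_at_def)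
  have small_K: "small U (K a)" for a
    by (rule small_subset[OF small_I]) (auto simp: K_def)
  have small_bd: "small U A" if "A \<in> bounded_at X C \<xi>" for A
    using that by (intro small_subset[OF X]) (simp add: bounded_at_def)
  have xyX: "x \<in> star_set U X" "y \<in> star_set U X"
    using xy by (auto simp: INF_pts_def)
  obtain F where F: "\<And>a. internal U (F a)"
    "\<And>a b. imem U b (F a) \<longleftrightarrow> b \<in> star_set U (K a) \<and> \<not> imem U x b \<and> \<not> imem U y b"
    using internal_avoiding[OF X small_K xyX] by metis
  have "\<exists>b. \<forall>a\<in>I. imem U b (F a)"
  proof (rule saturation_principle[OF small_I], intro ballI F, intro allI impI)
    fix J
    assume J: "finite J \<and> J \<subseteq> I"
    then obtain A where A: "A \<in> bounded_at X C \<xi>" "\<Union>(elts U ` J) \<subseteq> A"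
      using bounded_at_finite_Union[OF pcs, of "elts U ` J"] by (auto simp: I_def)
    obtain B where B: "B \<in> bounded_at X C \<xi>" "A \<subseteq> B" "connected_by E (X - B)"
      using cofinal A by blast
    have "star U (code U B) \<in> star_set U (K a)" if "a \<in> J" for a
      using that A B
      by (intro star_in_star_set[OF small_K])
        (auto simp: K_def I_def setp_code elts_code small_bd)
    moreover have "star_set U B \<subseteq> FIN_pts U X C \<xi>"
      using B FIN_pts_eq[OF X pcs] by blast
    ultimately have "\<forall>a\<in>J. imem U (star U (code U B)) (F a)"
      using xy by (auto simp: F INF_pts_def)
    then show "\<exists>b. \<forall>a\<in>J. imem U b (F a)" by blast
  qed
  then obtain b where b: "\<And>a. a \<in> I \<Longrightarrow> b \<in> star_set U (K a)"
    "\<And>a. a \<in> I \<Longrightarrow> \<not> imem U x b" "\<And>a. a \<in> I \<Longrightarrow> \<not> imem U y b"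
    using F by blast
  have code_I: "code U A \<in> I" if "A \<in> bounded_at X C \<xi>" for A
    using that small_bd by (simp add: I_def setp_code elts_code)
  have FIN: "imem U z b" if z: "z \<in> FIN_pts U X C \<xi>" for z
  proof -
    obtain A where A: "A \<in> bounded_at X C \<xi>" "z \<in> star_set U A"
      using z FIN_pts_eq[OF X pcs] by blast
    have "sat (smem U) (BAll 0 1 (BAll 2 3 (Mem 2 0)))
      ((\<lambda>_. undefined)(1 := code U (K (code U A)), 3 := code U A))"
      using A by (auto simp: small_K small_bd) (auto simp: K_def elts_code small_bd elts_def)
    from transfer[OF this] show ?thesis
      using b(1)[OF code_I[OF A(1)]] A(2) by auto
  qed
  define a where "a = code U {\<xi>}"
  have "a \<in> I" unfolding a_def by (rule code_I[OF bounded_at_singleton[OF pcs]])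
  show thesis
    by (rule that[OF small_K[of a] _ b[OF \<open>a \<in> I\<close>]]) (use FIN in \<open>auto simp: K_def\<close>)
qed

text \<open>
  Under the non-scattering hypothesis the relation is total on the infinite points, so the
  quotient can be computed without showing that the relation is an equivalence.
\<close>

lemma iota_rel_eq:
  assumes X: "small U X" and pcs: "pointed_coarse_space X C \<xi>"
    and ns: "non_scattering X C \<xi>"
  shows "iota_rel U X C \<xi> = INF_pts U X C \<xi> \<times> INF_pts U X C \<xi>"
proof -
  obtain E where E: "E \<in> C"
    "\<forall>A\<in>bounded_at X C \<xi>. \<exists>B\<in>bounded_at X C \<xi>. A \<subseteq> B \<and> connected_by E (X - B)"
    using ns by (auto simp: non_scattering_def)
  have EX: "E \<subseteq> X \<times> X"
    using pcs E(1) by (auto simp: pointed_coarse_space_def coarse_structure_def)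
  have "(x, y) \<in> iota_rel U X C \<xi>" if xy: "x \<in> INF_pts U X C \<xi>" "y \<in> INF_pts U X C \<xi>" for x y
  proof -
    obtain K b where K: "small U K" "\<And>b. b \<in> K \<Longrightarrow> connected_by E (X - elts U b)"
      and b: "b \<in> star_set U K" "\<not> imem U x b" "\<not> imem U y b"
        "\<forall>z\<in>FIN_pts U X C \<xi>. imem U z b"
      using internal_bounded_set[OF X pcs E(2) xy] by metis
    have xyX: "x \<in> star_set U X" "y \<in> star_set U X"
      using xy by (auto simp: INF_pts_def)
    obtain n g where n: "n \<in> hypernats U" and g: "internal U g"
      and path: "is_path (imem U) (hypernats U) (hyper_le U) (hyper_less U) (hyper_suc U)
        (star U (num U 0)) (star_set U X) (star_rel U E) b x y n g"
      using internal_path[OF X EX K b(1) xyX b(2,3)] by blast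
    obtain s where s: "internal_sequence U n s"
      "\<And>i. (i, n) \<in> hyper_le U \<Longrightarrow> s i \<in> star_set U X \<and> \<not> imem U (s i) b"
      "s (star U (num U 0)) = x" "s n = y"
      "\<And>i j. (i, n) \<in> hyper_less U \<Longrightarrow> (i, j) \<in> hyper_suc U \<Longrightarrow> (s i, s j) \<in> star_rel U E"
      by (rule sequence_of_path[OF path g]) blast
    have "s i \<in> INF_pts U X C \<xi>" if "(i, n) \<in> hyper_le U" for i
      using s(2)[OF that] b(4) by (auto simp: INF_pts_def)
    moreover have "finitely_close U C (s i) (s j)"
      if "(i, n) \<in> hyper_less U" "(i, j) \<in> hyper_suc U" for i j
      using s(5)[OF that] E(1) by (auto simp: finitely_close_def)
    ultimately show ?thesis
      using xy n s(1,3,4) unfolding iota_rel_def by blast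
  qed
  then show ?thesis by (auto simp: iota_rel_def)
qed

end


section \<open>At most one equivalence class of infinite points\<close>

theorem proposition3p17:
  fixes U :: "('u, 'v) universe"
    and X :: "'u set"
    and C :: "('u \<times> 'u) set set"
    and \<xi> :: 'u
  assumes "nonstandard_universe U"
    and "small U X"
    and "pointed_coarse_space X C \<xi>"
    and "non_scattering X C \<xi>"
  shows "iota U X C \<xi> = {} \<or> is_singleton (iota U X C \<xi>)"
proof -
  interpret nonstandard_universe U by fact
  have "iota U X C \<xi> \<subseteq> {INF_pts U X C \<xi>}"
    unfolding iota_def iota_rel_eq[OF assms(2-4)] quotient_def by auto
  then show ?thesis
    by (auto simp: subset_singleton_iff)
qed

end
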